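(* Let $f\in T_{\mathbb{S}(I)}(X,\mathcal{P})$. Then $f$ is a regular element of the semigroup $T_{\mathbb{S}(I)}(X,\mathcal{P})$ if and only if there exists $\alpha\in \mathbb{S}(I)$ such that: (i) $\chi^{(f)}\alpha\chi^{(f)}=\chi^{(f)}$; and (ii) $X_i\cap Xf\subseteq X_{i\alpha}f$ for all $i\in I\chi^{(f)}$.
   Context: $X$ is a nonempty set (possibly infinite) and $\mathcal{P}=\{X_i : i\in I\}$ is a partition of $X$ into nonempty blocks, with $X_i\cap X_j=\varnothing$ for $i\neq j$. $T(Z)$ denotes the semigroup of all maps $Z\to Z$ under composition. Maps are written on the right and composed from left to right: $x(fg)=(xf)g$; $Af=\{af: a\in A\}$. $T(X,\mathcal{P})$ is the subsemigroup of all $f\in T(X)$ such that for every $i\in I$ there is $j\in I$ with $X_if\subseteq X_j$. For $f\in T(X,\mathcal{P})$ the character $\chi^{(f)}\in T(I)$ is defined by $i\chi^{(f)}=j$ whenever $X_if\subseteq X_j$. $\mathbb{S}(I)$ is an arbitrary subsemigroup of $T(I)$, and $T_{\mathbb{S}(I)}(X,\mathcal{P})=\{f\in T(X,\mathcal{P}): \chi^{(f)}\in \mathbb{S}(I)\}$, a subsemigroup of $T(X,\mathcal{P})$. An element $a$ of a semigroup $S$ is regular in $S$ if there is $b\in S$ with $aba=a$. *)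

theory Defs
  imports "HOL-Library.FuncSet" "HOL-Library.Disjoint_Sets"
begin

text \<open>
  Maps on a carrier \<open>Z\<close> are extensional functions, so that equality in \<open>Z \<rightarrow>\<^sub>E Z\<close> is equality of
  maps on \<open>Z\<close>.  Products are read from left to right: \<open>x (f g) = (x f) g\<close>.
\<close>

definition full_transf :: "'a set \<Rightarrow> ('a \<Rightarrow> 'a) set" where
  "full_transf Z = Z \<rightarrow>\<^sub>E Z"

definition transf_mult :: "'a set \<Rightarrow> ('a \<Rightarrow> 'a) \<Rightarrow> ('a \<Rightarrow> 'a) \<Rightarrow> ('a \<Rightarrow> 'a)" where
  "transf_mult Z f g = compose Z g f"

definition subsemigroup :: "'s set \<Rightarrow> 's set \<Rightarrow> ('s \<Rightarrow> 's \<Rightarrow> 's) \<Rightarrow> bool" where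
  "subsemigroup H S m \<longleftrightarrow> H \<subseteq> S \<and> H \<noteq> {} \<and> (\<forall>a\<in>H. \<forall>b\<in>H. m a b \<in> H)"

definition regular_in :: "'s set \<Rightarrow> ('s \<Rightarrow> 's \<Rightarrow> 's) \<Rightarrow> 's \<Rightarrow> bool" where
  "regular_in S m a \<longleftrightarrow> a \<in> S \<and> (\<exists>b\<in>S. m (m a b) a = a)"

definition indexed_partition :: "'a set \<Rightarrow> 'i set \<Rightarrow> ('i \<Rightarrow> 'a set) \<Rightarrow> bool" where
  "indexed_partition X I P \<longleftrightarrow>
     (\<Union>i\<in>I. P i) = X \<and> (\<forall>i\<in>I. P i \<noteq> {}) \<and> disjoint_family_on P I"

definition part_transf :: "'a set \<Rightarrow> 'i set \<Rightarrow> ('i \<Rightarrow> 'a set) \<Rightarrow> ('a \<Rightarrow> 'a) set" where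
  "part_transf X I P = {f \<in> full_transf X. \<forall>i\<in>I. \<exists>j\<in>I. f ` P i \<subseteq> P j}"

definition character :: "'i set \<Rightarrow> ('i \<Rightarrow> 'a set) \<Rightarrow> ('a \<Rightarrow> 'a) \<Rightarrow> ('i \<Rightarrow> 'i)" where
  "character I P f = (\<lambda>i\<in>I. THE j. j \<in> I \<and> f ` P i \<subseteq> P j)"

definition part_transf_char ::
  "'a set \<Rightarrow> 'i set \<Rightarrow> ('i \<Rightarrow> 'a set) \<Rightarrow> ('i \<Rightarrow> 'i) set \<Rightarrow> ('a \<Rightarrow> 'a) set" where
  "part_transf_char X I P S = {f \<in> part_transf X I P. character I P f \<in> S}"

lemma character_eq_iff:
  assumes "indexed_partition X I P" "f \<in> part_transf X I P" "i \<in> I" "j \<in> I"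
  shows "character I P f i = j \<longleftrightarrow> f ` P i \<subseteq> P j"
proof -
  obtain x where x: "x \<in> P i"
    using assms(1,3) by (auto simp: indexed_partition_def)
  have uniq: "k = l" if "k \<in> I" "l \<in> I" "f ` P i \<subseteq> P k" "f ` P i \<subseteq> P l" for k l
  proof (rule ccontr)
    assume "k \<noteq> l"
    then have "P k \<inter> P l = {}"
      using assms(1) that(1,2) by (simp add: indexed_partition_def disjoint_family_on_def)
    moreover have "f x \<in> P k" "f x \<in> P l"
      using that(3,4) x by (simp_all add: image_subset_iff)
    ultimately show False by blast
  qed
  obtain k where k: "k \<in> I" "f ` P i \<subseteq> P k"
    using assms(2,3) by (auto simp: part_transf_def)
  have "(THE j. j \<in> I \<and> f ` P i \<subseteq> P j) = k"
    by (rule the_equality) (use k uniq in simp_all)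
  then have "character I P f i = k"
    using assms(3) by (simp add: character_def)
  then show ?thesis
    using k uniq[OF k(1) assms(4) k(2)] by metis
qed

lemma character_in_full_transf:
  assumes "indexed_partition X I P" "f \<in> part_transf X I P"
  shows "character I P f \<in> full_transf I"
  unfolding full_transf_def
proof (rule PiE_I)
  fix i assume i: "i \<in> I"
  then obtain j where j: "j \<in> I" "f ` P i \<subseteq> P j"
    using assms(2) by (auto simp: part_transf_def)
  with character_eq_iff[OF assms i j(1)] have "character I P f i = j" by simp
  with j(1) show "character I P f i \<in> I" by simp
next
  fix i assume "i \<notin> I"
  then show "character I P f i = undefined" by (simp add: character_def)
qed

end

theory Submission
  imports Defs
begin

text \<open>
  Two facts carry the proof.  The character is multiplicative, so an inner inverse \<open>g\<close> of \<open>f\<close>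
  (that is, \<open>f g f = f\<close>) has a character that is an inner inverse of the character of \<open>f\<close>.
  And an inner inverse of \<open>f\<close> is precisely a map that sends every point of the image of \<open>f\<close> to one
  of its preimages.

  Hence, if \<open>g\<close> has character \<open>\<alpha>\<close>, a point \<open>x\<close> of the image lying in the block \<open>P i\<close> has a preimage
  in \<open>P (\<alpha> i)\<close>, namely \<open>g x\<close>: this is the second condition.  Conversely, that condition lets one
  choose for each image point in \<open>P i\<close> a preimage in \<open>P (\<alpha> i)\<close>; sending each remaining point of
  \<open>P i\<close> anywhere in \<open>P (\<alpha> i)\<close> gives an inner inverse whose character is exactly \<open>\<alpha>\<close>, so that it
  stays inside the semigroup whenever \<open>\<alpha> \<in> S\<close>.
\<close>

lemma apply_in_character_block:
  assumes "indexed_partition X I P" "f \<in> part_transf X I P" "i \<in> I" "x \<in> P i"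
  shows "character I P f i \<in> I" "f x \<in> P (character I P f i)"
proof -
  show char_mem: "character I P f i \<in> I"
    using character_in_full_transf[OF assms(1,2)] assms(3) by (auto simp: full_transf_def)
  show "f x \<in> P (character I P f i)"
    using character_eq_iff[OF assms(1-3) char_mem] assms(4) by blast
qed

lemma part_transfI:
  assumes "f \<in> full_transf X" "\<alpha> \<in> full_transf I" "\<And>i. i \<in> I \<Longrightarrow> f ` P i \<subseteq> P (\<alpha> i)"
  shows "f \<in> part_transf X I P"
proof -
  have "\<exists>j\<in>I. f ` P i \<subseteq> P j" if "i \<in> I" for i
    using assms(2) assms(3)[OF that] that by (auto simp: full_transf_def)
  then show ?thesis
    using assms(1) by (simp add: part_transf_def)
qed

lemma character_eqI:
  assumes "indexed_partition X I P" "f \<in> part_transf X I P"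
    and "\<alpha> \<in> full_transf I" "\<And>i. i \<in> I \<Longrightarrow> f ` P i \<subseteq> P (\<alpha> i)"
  shows "character I P f = \<alpha>"
proof (rule PiE_ext)
  show "character I P f \<in> I \<rightarrow>\<^sub>E I"
    using character_in_full_transf[OF assms(1,2)] by (simp add: full_transf_def)
  show "\<alpha> \<in> I \<rightarrow>\<^sub>E I"
    using assms(3) by (simp add: full_transf_def)
  fix i assume i: "i \<in> I"
  then have "\<alpha> i \<in> I"
    using assms(3) by (auto simp: full_transf_def)
  then show "character I P f i = \<alpha> i"
    using character_eq_iff[OF assms(1,2) i] assms(4)[OF i] by simp
qed

lemma transf_mult_closed:
  assumes "f \<in> full_transf Z" "g \<in> full_transf Z"
  shows "transf_mult Z f g \<in> full_transf Z"
  using assms by (auto simp: full_transf_def transf_mult_def compose_def)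

lemma character_transf_mult:
  assumes part: "indexed_partition X I P"
    and f: "f \<in> part_transf X I P" and g: "g \<in> part_transf X I P"
  shows "transf_mult X f g \<in> part_transf X I P"
    and "character I P (transf_mult X f g) = transf_mult I (character I P f) (character I P g)"
proof -
  let ?\<alpha> = "transf_mult I (character I P f) (character I P g)"
  have full: "?\<alpha> \<in> full_transf I"
    by (intro transf_mult_closed character_in_full_transf[OF part] f g)
  have blocks: "transf_mult X f g ` P i \<subseteq> P (?\<alpha> i)" if i: "i \<in> I" for i
  proof
    fix y assume "y \<in> transf_mult X f g ` P i"
    then obtain x where x: "x \<in> P i" "y = transf_mult X f g x" by blast
    have "x \<in> X"
      using part i x(1) by (auto simp: indexed_partition_def)
    then have "y = g (f x)"
      using x(2) by (simp add: transf_mult_def compose_eq)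
    moreover have "g (f x) \<in> P (character I P g (character I P f i))"
      by (rule apply_in_character_block(2)[OF part g apply_in_character_block[OF part f i x(1)]])
    ultimately show "y \<in> P (?\<alpha> i)"
      using i by (simp add: transf_mult_def compose_eq)
  qed
  show mem: "transf_mult X f g \<in> part_transf X I P"
  proof (rule part_transfI[where P = P, OF _ full blocks])
    show "transf_mult X f g \<in> full_transf X"
      using f g by (intro transf_mult_closed) (simp_all add: part_transf_def)
  qed
  show "character I P (transf_mult X f g) = ?\<alpha>"
    by (rule character_eqI[where P = P, OF part mem full blocks])
qed

text \<open>
  The defining equation of an inner inverse, evaluated at a point \<open>x\<close>, says that \<open>g\<close> sends the
  image point \<open>f x\<close> to a preimage of it.  The equation alone therefore constrains \<open>g\<close> only on the
  image of \<open>f\<close>.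
\<close>
lemma inner_inverse_iff:
  assumes "f \<in> full_transf X"
  shows "transf_mult X (transf_mult X f g) f = f \<longleftrightarrow> (\<forall>y\<in>f ` X. f (g y) = y)"
proof
  assume eq: "transf_mult X (transf_mult X f g) f = f"
  have "f (g (f x)) = f x" if "x \<in> X" for x
    using fun_cong[OF eq, of x] that by (simp only: transf_mult_def compose_eq)
  then show "\<forall>y\<in>f ` X. f (g y) = y" by blast
next
  assume preimage: "\<forall>y\<in>f ` X. f (g y) = y"
  show "transf_mult X (transf_mult X f g) f = f"
  proof
    fix x
    show "transf_mult X (transf_mult X f g) f x = f x"
    proof (cases "x \<in> X")
      case True
      then have "f (g (f x)) = f x"
        using preimage by blast
      with True show ?thesis
        by (simp only: transf_mult_def compose_eq)
    next
      case False
      then have "f x = undefined"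
        using assms by (auto simp: full_transf_def)
      with False show ?thesis
        by (simp add: transf_mult_def compose_def)
    qed
  qed
qed

lemma inner_inverse_imp_image_condition:
  assumes part: "indexed_partition X I P"
    and f: "f \<in> full_transf X" and g: "g \<in> part_transf X I P"
    and inner: "transf_mult X (transf_mult X f g) f = f" and i: "i \<in> I"
  shows "P i \<inter> f ` X \<subseteq> f ` P (character I P g i)"
proof
  fix y assume y: "y \<in> P i \<inter> f ` X"
  then have "y = f (g y)"
    using inner unfolding inner_inverse_iff[OF f] by auto
  moreover have "g y \<in> P (character I P g i)"
    using apply_in_character_block(2)[OF part g i] y by blast
  ultimately show "y \<in> f ` P (character I P g i)" by blast
qed

text \<open>
  The choice of preimages can be made independently at each point, because a map respects the
  partition with character \<open>\<alpha>\<close> as soon as each point of \<open>P i\<close> goes into \<open>P (\<alpha> i)\<close>.  The image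
  condition provides a preimage for every image point, because a block that meets the image of \<open>f\<close>
  is indexed by a value of the character of \<open>f\<close>.
\<close>
lemma inner_inverse_with_character:
  assumes part: "indexed_partition X I P" and f: "f \<in> part_transf X I P"
    and \<alpha>: "\<alpha> \<in> full_transf I"
    and cond: "\<And>i. i \<in> character I P f ` I \<Longrightarrow> P i \<inter> f ` X \<subseteq> f ` P (\<alpha> i)"
  obtains g where "g \<in> part_transf X I P" "character I P g = \<alpha>"
    "transf_mult X (transf_mult X f g) f = f"
proof -
  have cover: "X = (\<Union>i\<in>I. P i)"
    using part by (simp add: indexed_partition_def)
  have unique: "i = j" if "i \<in> I" "j \<in> I" "x \<in> P i" "x \<in> P j" for i j x
    using part that by (auto simp: indexed_partition_def disjoint_family_on_def)
  have \<alpha>_mem: "\<alpha> i \<in> I" if "i \<in> I" for i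
    using \<alpha> that by (auto simp: full_transf_def)
  have choice: "\<exists>y. (\<forall>i\<in>I. x \<in> P i \<longrightarrow> y \<in> P (\<alpha> i)) \<and> (x \<in> f ` X \<longrightarrow> f y = x)"
    if x: "x \<in> X" for x
  proof -
    obtain i where i: "i \<in> I" "x \<in> P i"
      using x cover by blast
    have "\<exists>y\<in>P (\<alpha> i). x \<in> f ` X \<longrightarrow> f y = x"
    proof (cases "x \<in> f ` X")
      case True
      then obtain z k where z: "x = f z" "k \<in> I" "z \<in> P k"
        using cover by blast
      then have "i = character I P f k"
        using apply_in_character_block[OF part f z(2,3)] unique[OF i(1) _ i(2)] by simp
      then have "x \<in> f ` P (\<alpha> i)"
        using cond[of i] z(2) i(2) True by blast
      then show ?thesis by blast
    next
      case False
      have "P (\<alpha> i) \<noteq> {}"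
        using part \<alpha>_mem[OF i(1)] by (simp add: indexed_partition_def)
      then show ?thesis using False by blast
    qed
    then show ?thesis
      using unique[OF i(1) _ i(2)] by blast
  qed
  then obtain h where h: "\<And>x i. x \<in> X \<Longrightarrow> i \<in> I \<Longrightarrow> x \<in> P i \<Longrightarrow> h x \<in> P (\<alpha> i)"
      "\<And>x. x \<in> X \<Longrightarrow> x \<in> f ` X \<Longrightarrow> f (h x) = x"
    by metis
  define g where "g = restrict h X"
  have blocks: "g ` P i \<subseteq> P (\<alpha> i)" if "i \<in> I" for i
    using h(1) that cover by (auto simp: g_def)
  have "g \<in> full_transf X"
    unfolding full_transf_def g_def
    by (rule restrict_PiE_iff[THEN iffD2]) (use h(1) cover \<alpha>_mem in blast)
  then have g: "g \<in> part_transf X I P"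
    by (rule part_transfI[where P = P, OF _ \<alpha> blocks])
  have f_full: "f \<in> full_transf X"
    using f by (simp add: part_transf_def)
  then have "f ` X \<subseteq> X"
    by (auto simp: full_transf_def)
  then have "transf_mult X (transf_mult X f g) f = f"
    unfolding inner_inverse_iff[OF f_full] using h(2) by (auto simp: g_def)
  then show thesis
    using that g character_eqI[where P = P, OF part g \<alpha> blocks] by blast
qed

theorem theorem3p3:
  fixes X :: "'a set" and I :: "'i set" and P :: "'i \<Rightarrow> 'a set"
    and S :: "('i \<Rightarrow> 'i) set" and f :: "'a \<Rightarrow> 'a"
  assumes "X \<noteq> {}"
    and "indexed_partition X I P"
    and "subsemigroup S (full_transf I) (transf_mult I)"
    and "f \<in> part_transf_char X I P S"
  shows "regular_in (part_transf_char X I P S) (transf_mult X) f \<longleftrightarrow>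
    (\<exists>\<alpha>\<in>S.
       transf_mult I (transf_mult I (character I P f) \<alpha>) (character I P f) = character I P f \<and>
       (\<forall>i\<in>character I P f ` I. P i \<inter> f ` X \<subseteq> f ` P (\<alpha> i)))"
    (is "?regular \<longleftrightarrow> (\<exists>\<alpha>\<in>S. ?inner \<alpha> \<and> ?image \<alpha>)")
proof -
  have f: "f \<in> part_transf X I P" and f_full: "f \<in> full_transf X"
    using assms(4) by (simp_all add: part_transf_char_def part_transf_def)
  show ?thesis
  proof
    assume ?regular
    then obtain g where g: "g \<in> part_transf X I P" "character I P g \<in> S"
      and inner: "transf_mult X (transf_mult X f g) f = f"
      by (auto simp: regular_in_def part_transf_char_def)
    have "?inner (character I P g)"
      using character_transf_mult[OF assms(2)] f g(1) inner by metis
    moreover have "?image (character I P g)"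
      using inner_inverse_imp_image_condition[OF assms(2) f_full g(1) inner]
        character_in_full_transf[OF assms(2) f] by (auto simp: full_transf_def)
    ultimately show "\<exists>\<alpha>\<in>S. ?inner \<alpha> \<and> ?image \<alpha>"
      using g(2) by blast
  next
    assume "\<exists>\<alpha>\<in>S. ?inner \<alpha> \<and> ?image \<alpha>"
    then obtain \<alpha> where \<alpha>: "\<alpha> \<in> S" "?image \<alpha>" by blast
    have "\<alpha> \<in> full_transf I"
      using assms(3) \<alpha>(1) by (auto simp: subsemigroup_def)
    then obtain g where "g \<in> part_transf X I P" "character I P g = \<alpha>"
      "transf_mult X (transf_mult X f g) f = f"
      using inner_inverse_with_character[OF assms(2) f] \<alpha>(2) by metis
    then show ?regular
      using assms(4) \<alpha>(1) by (auto simp: regular_in_def part_transf_char_def)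
  qed
qed

end
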